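(* Let $(X, \{*_j\}_{j=1}^k)$ be a mutually distributive set, where $*_j$ is an $n_j$-ary operation on $X$. For $n\ge 1$ and $\vec{\epsilon}=(\epsilon_1,\dots,\epsilon_{n-1})\in\{1,\dots,k\}^{n-1}$, let $C_n^{\vec\epsilon}(X)$ be the free abelian group generated by tuples $(x_0,(\mathbf{x}_1,\epsilon_1),\dots,(\mathbf{x}_{n-1},\epsilon_{n-1}))$ with $x_0\in X$ and $\mathbf{x}_i\in X^{n_{\epsilon_i}-1}$, let $C_n(X)=\bigoplus_{\vec\epsilon} C_n^{\vec\epsilon}(X)$, and let $\partial_n : C_n(X)\to C_{n-1}(X)$ be the homomorphism given on generators by $$\partial_n\bigl(x_0,(\mathbf{x}_1,\epsilon_1),\dots,(\mathbf{x}_{n-1},\epsilon_{n-1})\bigr)=\sum_{i=1}^{n-1}(-1)^i\Bigl[\bigl(x_0*_{\epsilon_i}\mathbf{x}_i,(\mathbf{x}_1*_{\epsilon_i}\mathbf{x}_i,\epsilon_1),\dots,(\mathbf{x}_{i-1}*_{\epsilon_i}\mathbf{x}_i,\epsilon_{i-1}),(\mathbf{x}_{i+1},\epsilon_{i+1}),\dots,(\mathbf{x}_{n-1},\epsilon_{n-1})\bigr)-\bigl(x_0,(\mathbf{x}_1,\epsilon_1),\dots,\widehat{(\mathbf{x}_i,\epsilon_i)},\dots,(\mathbf{x}_{n-1},\epsilon_{n-1})\bigr)\Bigr].$$ Then $(C_n(X),\partial_n)$ is a chain complex, i.e. $\partial_{n-1}\circ\partial_n=0$ for all $n$.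
   Context: Notation: for an $n$-ary operation $*$ on $X$ and $\mathbf{y}\in X^{n-1}$, $x*\mathbf{y}$ denotes the value of the operation at $(x,y_1,\dots,y_{n-1})$, and for $\mathbf{x}=(x_1,\dots,x_m)\in X^m$, $\mathbf{x}*\mathbf{y}=(x_1*\mathbf{y},\dots,x_m*\mathbf{y})$. An $n$-ary operation is distributive if $(x*\mathbf{y})*\mathbf{z}=(x*\mathbf{z})*(\mathbf{y}*\mathbf{z})$ for all $x\in X$, $\mathbf{y},\mathbf{z}\in X^{n-1}$. Two distributive operations $*$ and $*'$ (of possibly different arities) are mutually distributive if $(x*\mathbf{y})*'\mathbf{z}=(x*'\mathbf{z})*(\mathbf{y}*'\mathbf{z})$ and $(x*'\mathbf{u})*\mathbf{v}=(x*\mathbf{v})*'(\mathbf{u}*\mathbf{v})$ for all $x\in X$ and all vectors of the appropriate lengths. A mutually distributive set $(X,\{*_j\}_{j=1}^k)$ is a set $X$ with finitely many distributive operations that are pairwise mutually distributive. A hat denotes omission. Convention: $C_n(X)=0$ for $n\le 0$. *)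

theory Defs
  imports "HOL-Algebra.Free_Abelian_Groups"
begin

definition tuples :: "'a set \<Rightarrow> nat \<Rightarrow> 'a list set" where
  "tuples X m = {xs \<in> lists X. length xs = m}"

text \<open>
  An operation of arity \<open>n\<close> takes its arguments as one list, so \<open>x * y\<close> is \<open>f (x # ys)\<close>.
  The arity is at least 1, since \<open>y\<close> ranges over \<open>X\<close> to the power \<open>n - 1\<close>
  (and the subtraction on \<^typ>\<open>nat\<close> is therefore exact).
\<close>

definition nary_operation :: "'a set \<Rightarrow> nat \<Rightarrow> ('a list \<Rightarrow> 'a) \<Rightarrow> bool" where
  "nary_operation X n f \<longleftrightarrow> 1 \<le> n \<and> f \<in> tuples X n \<rightarrow> X"

definition act :: "('a list \<Rightarrow> 'a) \<Rightarrow> 'a \<Rightarrow> 'a list \<Rightarrow> 'a" where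
  "act f x ys = f (x # ys)"

definition act_tuple :: "('a list \<Rightarrow> 'a) \<Rightarrow> 'a list \<Rightarrow> 'a list \<Rightarrow> 'a list" where
  "act_tuple f xs ys = map (\<lambda>x. act f x ys) xs"

definition distributive_operation :: "'a set \<Rightarrow> nat \<Rightarrow> ('a list \<Rightarrow> 'a) \<Rightarrow> bool" where
  "distributive_operation X n f \<longleftrightarrow>
     nary_operation X n f \<and>
     (\<forall>x\<in>X. \<forall>ys\<in>tuples X (n - 1). \<forall>zs\<in>tuples X (n - 1).
        act f (act f x ys) zs = act f (act f x zs) (act_tuple f ys zs))"

definition mutually_distributive ::
  "'a set \<Rightarrow> nat \<Rightarrow> ('a list \<Rightarrow> 'a) \<Rightarrow> nat \<Rightarrow> ('a list \<Rightarrow> 'a) \<Rightarrow> bool" where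
  "mutually_distributive X n f m g \<longleftrightarrow>
     (\<forall>x\<in>X. \<forall>ys\<in>tuples X (n - 1). \<forall>zs\<in>tuples X (m - 1).
        act g (act f x ys) zs = act f (act g x zs) (act_tuple g ys zs)) \<and>
     (\<forall>x\<in>X. \<forall>us\<in>tuples X (m - 1). \<forall>vs\<in>tuples X (n - 1).
        act f (act g x us) vs = act g (act f x vs) (act_tuple f us vs))"

definition mutually_distributive_set ::
  "'a set \<Rightarrow> nat \<Rightarrow> (nat \<Rightarrow> nat) \<Rightarrow> (nat \<Rightarrow> 'a list \<Rightarrow> 'a) \<Rightarrow> bool" where
  "mutually_distributive_set X k ar f \<longleftrightarrow>
     (\<forall>j\<in>{1..k}. distributive_operation X (ar j) (f j)) \<and>
     (\<forall>i\<in>{1..k}. \<forall>j\<in>{1..k}. i \<noteq> j \<longrightarrow>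
        mutually_distributive X (ar i) (f i) (ar j) (f j))"

type_synonym 'a generator = "'a \<times> ('a list \<times> nat) list"

definition generators :: "'a set \<Rightarrow> (nat \<Rightarrow> nat) \<Rightarrow> nat list \<Rightarrow> 'a generator set" where
  "generators X ar es =
     {(x, ps). x \<in> X \<and> map snd ps = es \<and> (\<forall>(ys, e)\<in>set ps. ys \<in> tuples X (ar e - 1))}"

text \<open>Degrees are integers; the length condition leaves no index vector in degrees \<open>n \<le> 0\<close>.\<close>

definition index_vectors :: "nat \<Rightarrow> int \<Rightarrow> nat list set" where
  "index_vectors k n = {es \<in> lists {1..k}. int (length es) = n - 1}"

definition chain_summand ::
  "'a set \<Rightarrow> (nat \<Rightarrow> nat) \<Rightarrow> nat list \<Rightarrow> ('a generator \<Rightarrow>\<^sub>0 int) monoid" where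
  "chain_summand X ar es = free_Abelian_group (generators X ar es)"

text \<open>
  A generator records its index vector, so the generating sets of the summands are disjoint and
  their direct sum is taken internally, as the free abelian group on the union; the first lemma
  below identifies it with the external direct sum.
\<close>

definition chain_group ::
  "'a set \<Rightarrow> nat \<Rightarrow> (nat \<Rightarrow> nat) \<Rightarrow> int \<Rightarrow> ('a generator \<Rightarrow>\<^sub>0 int) monoid" where
  "chain_group X k ar n = free_Abelian_group (\<Union>es\<in>index_vectors k n. generators X ar es)"

lemma sum_group_iso_chain_group:
  "(\<lambda>c. sum' c (index_vectors k n))
     \<in> iso (sum_group (index_vectors k n) (chain_summand X ar)) (chain_group X k ar n)"
proof -
  have "pairwise (\<lambda>i j. disjnt (generators X ar i) (generators X ar j)) (index_vectors k n)"
    by (auto simp: pairwise_def disjnt_def generators_def)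
  from iso_free_Abelian_group_sum [OF this] show ?thesis
    by (simp add: chain_group_def chain_summand_def [abs_def])
qed

lemma chain_group_nonpos:
  assumes "n \<le> 0" shows "carrier (chain_group X k ar n) = {0}"
  using assms by (auto simp: chain_group_def index_vectors_def free_Abelian_group_def)

text \<open>
  In the faces \<open>i\<close> counts from 1, so the \<open>i\<close>-th pair is \<open>ps ! (i - 1)\<close>.
\<close>

definition face_act :: "(nat \<Rightarrow> 'a list \<Rightarrow> 'a) \<Rightarrow> nat \<Rightarrow> 'a generator \<Rightarrow> 'a generator" where
  "face_act f i = (\<lambda>(x, ps). case ps ! (i - 1) of (ys, e) \<Rightarrow>
     (act (f e) x ys,
      map (\<lambda>(zs, d). (act_tuple (f e) zs ys, d)) (take (i - 1) ps) @ drop i ps))"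

definition face_omit :: "nat \<Rightarrow> 'a generator \<Rightarrow> 'a generator" where
  "face_omit i = (\<lambda>(x, ps). (x, take (i - 1) ps @ drop i ps))"

definition boundary ::
  "(nat \<Rightarrow> 'a list \<Rightarrow> 'a) \<Rightarrow> int \<Rightarrow> ('a generator \<Rightarrow>\<^sub>0 int) \<Rightarrow> ('a generator \<Rightarrow>\<^sub>0 int)" where
  "boundary f n = frag_extend (\<lambda>g. \<Sum>i = 1..nat (n - 1).
     frag_cmul ((- 1) ^ i) (frag_of (face_act f i g) - frag_of (face_omit i g)))"

definition chain_complex ::
  "(int \<Rightarrow> ('a, 'b) monoid_scheme) \<Rightarrow> (int \<Rightarrow> 'a \<Rightarrow> 'a) \<Rightarrow> bool" where
  "chain_complex C d \<longleftrightarrow>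
     (\<forall>n. comm_group (C n)) \<and>
     (\<forall>n. d n \<in> hom (C n) (C (n - 1))) \<and>
     (\<forall>n. \<forall>c\<in>carrier (C n). d (n - 1) (d n c) = \<one>\<^bsub>C (n - 2)\<^esub>)"

end

theory Submission
  imports Defs
begin

text \<open>
  For \<open>i < j\<close> the two kinds of faces satisfy the presimplicial identities
  \<open>d\<^sub>i d'\<^sub>j = d'\<^sub>j\<^sub>-\<^sub>1 d\<^sub>i\<close> in all four combinations; (mutual) distributivity is what makes the
  combination of two acting faces work. Hence their differences satisfy the presimplicial
  identities as well, and the terms of the squared alternating sum cancel in pairs.
\<close>

lemma alternating_double_sum_eq_0:
  fixes t :: "nat \<Rightarrow> nat \<Rightarrow> 'b::ab_group_add"
  assumes "\<And>i j. 1 \<le> i \<Longrightarrow> i < j \<Longrightarrow> j \<le> m \<Longrightarrow> t j i = - t i (j - 1)"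
  shows "(\<Sum>j = 1..m. \<Sum>i = 1..m - 1. t j i) = 0"
proof -
  define S where "S = {1..m} \<times> {1..m - 1}"
  have fin: "finite S" by (simp add: S_def)
  have "(\<Sum>j = 1..m. \<Sum>i = 1..m - 1. t j i) = (\<Sum>(j, i)\<in>S. t j i)"
    by (simp add: S_def sum.cartesian_product)
  also have "\<dots> = (\<Sum>(j, i)\<in>{p\<in>S. snd p < fst p}. t j i)
      + (\<Sum>(j, i)\<in>{p\<in>S. \<not> snd p < fst p}. t j i)"
    using fin by (subst sum.union_disjoint [symmetric]) (auto intro!: sum.cong)
  also have "(\<Sum>(j, i)\<in>{p\<in>S. snd p < fst p}. t j i)
      = (\<Sum>(j, i)\<in>{p\<in>S. \<not> snd p < fst p}. - t j i)"
    \<comment> \<open>The map \<open>(j, i)\<close> to \<open>(i, j - 1)\<close> carries the part of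
      the rectangle with \<open>i < j\<close> bijectively onto the rest, and by assumption it flips
      the sign of each term.\<close>
    by (rule sum.reindex_bij_witness
          [where i = "\<lambda>(j, i). (i + 1, j)" and j = "\<lambda>(j, i). (i, j - 1)"])
      (auto simp: S_def assms)
  finally show ?thesis
    by (simp add: case_prod_unfold sum_negf)
qed

text \<open>Puts a generator in a form where removing two positions is plain computation with
  appends.\<close>

lemma split_list_two_nths:
  assumes "i < j" "j < length ps"
  obtains A B C where "ps = A @ ps ! i # B @ ps ! j # C" "length A = i" "length B = j - Suc i"
proof
  have "drop (Suc i) ps = take (j - Suc i) (drop (Suc i) ps) @ drop (j - Suc i) (drop (Suc i) ps)"
    by (rule append_take_drop_id [symmetric])
  also have "drop (j - Suc i) (drop (Suc i) ps) = ps ! j # drop (Suc j) ps"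
    using assms by (simp add: Cons_nth_drop_Suc)
  finally show "ps = take i ps @ ps ! i # take (j - Suc i) (drop (Suc i) ps) @ ps ! j # drop (Suc j) ps"
    using assms id_take_nth_drop [of i ps] by simp
qed (use assms in auto)

text \<open>The definition separates distinct operations from a single one. For \<open>e = d\<close>
  the law is distributivity of that operation, so one rule covers all pairs of labels.\<close>

lemma mutually_distributive_setD:
  assumes "mutually_distributive_set X k ar f" "e \<in> {1..k}" "d \<in> {1..k}"
    and "x \<in> X" "ys \<in> tuples X (ar e - 1)" "zs \<in> tuples X (ar d - 1)"
  shows "act (f d) (act (f e) x ys) zs = act (f e) (act (f d) x zs) (act_tuple (f d) ys zs)"
  using assms
  by (cases "e = d")
    (auto simp: mutually_distributive_set_def distributive_operation_def mutually_distributive_def)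

lemma act_in:
  assumes "nary_operation X n f" "x \<in> X" "ys \<in> tuples X (n - 1)"
  shows "act f x ys \<in> X"
  using assms by (auto simp: nary_operation_def act_def tuples_def Pi_iff)

lemma act_tuple_in:
  assumes "nary_operation X n f" "xs \<in> tuples X m" "ys \<in> tuples X (n - 1)"
  shows "act_tuple f xs ys \<in> tuples X m"
  using assms act_in [OF assms(1) _ assms(3)] by (auto simp: act_tuple_def tuples_def)

lemma mutually_distributive_setD_tuple:
  assumes "mutually_distributive_set X k ar f" "e \<in> {1..k}" "d \<in> {1..k}"
    and "xs \<in> tuples X m" "ys \<in> tuples X (ar e - 1)" "zs \<in> tuples X (ar d - 1)"
  shows "act_tuple (f d) (act_tuple (f e) xs ys) zs
    = act_tuple (f e) (act_tuple (f d) xs zs) (act_tuple (f d) ys zs)"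
  using assms(4) mutually_distributive_setD [OF assms(1-3) _ assms(5,6)]
  by (auto simp: act_tuple_def tuples_def)

lemma generator_faces_commute:
  assumes "mutually_distributive_set X k ar f"
    and es: "set es \<subseteq> {1..k}" and g: "g \<in> generators X ar es"
    and ij: "1 \<le> i" "i < j" "j \<le> length es"
  shows "face_act f i (face_act f j g) = face_act f (j - 1) (face_act f i g)"
    and "face_act f i (face_omit j g) = face_omit (j - 1) (face_act f i g)"
    and "face_omit i (face_act f j g) = face_act f (j - 1) (face_omit i g)"
    and "face_omit i (face_omit j g) = face_omit (j - 1) (face_omit i g)"
proof -
  obtain x ps where gx: "g = (x, ps)" by (cases g)
  with g have x: "x \<in> X" and ps: "map snd ps = es"
    and T: "\<And>ys e. (ys, e) \<in> set ps \<Longrightarrow> ys \<in> tuples X (ar e - 1)"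
    by (auto simp: generators_def)
  have len: "length ps = length es" using ps by auto
  obtain A B C where "ps = A @ ps ! (i - 1) # B @ ps ! (j - 1) # C"
    and len_A: "length A = i - 1" and len_B: "length B = j - 1 - Suc (i - 1)"
    by (rule split_list_two_nths [of "i - 1" "j - 1" ps]) (use ij len in auto)
  then obtain ys e zs d where split: "ps = A @ (ys, e) # B @ (zs, d) # C"
    by (metis surj_pair)
  have i: "i = Suc (length A)" and j: "j = Suc (Suc (length A + length B))"
    using len_A len_B ij by auto
  have ed: "e \<in> {1..k}" "d \<in> {1..k}" using es unfolding ps [symmetric] split by auto
  have yz: "ys \<in> tuples X (ar e - 1)" "zs \<in> tuples X (ar d - 1)" using T split by auto
  note D = mutually_distributive_setD [OF assms(1) ed x yz]
  \<comment> \<open>\<open>D\<close> settles the entry \<open>x\<close>; the same law is needed for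
    each vector in front of position \<open>i\<close>.\<close>
  have DA: "act_tuple (f d) (act_tuple (f e) us ys) zs
      = act_tuple (f e) (act_tuple (f d) us zs) (act_tuple (f d) ys zs)"
    if "(us, c) \<in> set A" for us c
    using mutually_distributive_setD_tuple [OF assms(1) ed T yz] that split by auto
  show "face_act f i (face_act f j g) = face_act f (j - 1) (face_act f i g)"
    unfolding gx split i j by (auto simp: face_act_def nth_append D DA)
  show "face_act f i (face_omit j g) = face_omit (j - 1) (face_act f i g)"
    and "face_omit i (face_act f j g) = face_act f (j - 1) (face_omit i g)"
    and "face_omit i (face_omit j g) = face_omit (j - 1) (face_omit i g)"
    unfolding gx split i j by (auto simp: face_act_def face_omit_def nth_append)
qed

text \<open>Acting changes vectors but not their labels or lengths, so either face only deletes the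
  \<open>i\<close>-th label.\<close>

lemma
  assumes "mutually_distributive_set X k ar f"
    and es: "set es \<subseteq> {1..k}" and g: "g \<in> generators X ar es"
    and i: "1 \<le> i" "i \<le> length es"
  shows face_act_in: "face_act f i g \<in> generators X ar (take (i - 1) es @ drop i es)"
    and face_omit_in: "face_omit i g \<in> generators X ar (take (i - 1) es @ drop i es)"
proof -
  obtain x ps where gx: "g = (x, ps)" by (cases g)
  with g have x: "x \<in> X" and ps: "map snd ps = es"
    and T: "\<And>ys e. (ys, e) \<in> set ps \<Longrightarrow> ys \<in> tuples X (ar e - 1)"
    by (auto simp: generators_def)
  obtain ys e where ye: "ps ! (i - 1) = (ys, e)" by fastforce
  have "i - 1 < length ps" using i ps by auto
  with ye have mem: "(ys, e) \<in> set ps" by (metis nth_mem)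
  then have "e \<in> {1..k}" using es ps by force
  then have op: "nary_operation X (ar e) (f e)"
    using assms(1) by (auto simp: mutually_distributive_set_def distributive_operation_def)
  have snds: "map (snd \<circ> (\<lambda>(zs, d). (h zs, d))) = map snd" for h :: "'a list \<Rightarrow> 'a list"
    by (auto simp: fun_eq_iff)
  have "face_act f i g = (act (f e) x ys,
      map (\<lambda>(zs, d). (act_tuple (f e) zs ys, d)) (take (i - 1) ps) @ drop i ps)"
    by (simp only: gx face_act_def ye prod.case)
  then show "face_act f i g \<in> generators X ar (take (i - 1) es @ drop i es)"
    using x T act_in [OF op _ T [OF mem]] act_tuple_in [OF op _ T [OF mem]]
    by (auto simp: generators_def ps [symmetric] snds take_map drop_map
        dest!: in_set_takeD in_set_dropD)
  show "face_omit i g \<in> generators X ar (take (i - 1) es @ drop i es)"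
    using x T
    by (auto simp: gx face_omit_def generators_def ps [symmetric] take_map drop_map
        dest!: in_set_takeD in_set_dropD)
qed

text \<open>The bracket of the boundary formula, isolated so that the boundary becomes an
  alternating sum of linear maps.\<close>

definition face_diff :: "(nat \<Rightarrow> 'a list \<Rightarrow> 'a) \<Rightarrow> nat \<Rightarrow> 'a generator \<Rightarrow> 'a generator \<Rightarrow>\<^sub>0 int" where
  "face_diff f i g = frag_of (face_act f i g) - frag_of (face_omit i g)"

lemma frag_cmul_diff_right: "frag_cmul c (a - b) = frag_cmul c a - frag_cmul c b"
  by (simp add: poly_mapping_eqI lookup_minus right_diff_distrib)

text \<open>Both sides are additive in \<open>c\<close> and agree on generators, so the sum may be
  taken outside the linear extension.\<close>

lemma boundary_eq_sum:
  "boundary f n c = (\<Sum>i = 1..nat (n - 1). frag_cmul ((- 1) ^ i) (frag_extend (face_diff f i) c))"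
proof -
  have "Poly_Mapping.keys c \<subseteq> UNIV" by simp
  then show ?thesis
  proof (induction c rule: frag_induction)
    case (diff a b)
    then show ?case
      by (simp add: boundary_def frag_extend_diff frag_cmul_diff_right sum_subtractf)
  qed (simp_all add: boundary_def face_diff_def)
qed

text \<open>Each side expands into four terms. The two mixed terms trade places, as acting and
  omitting keep their own pair while the order changes.\<close>

lemma face_diff_commute:
  assumes "mutually_distributive_set X k ar f"
    and "set es \<subseteq> {1..k}" "g \<in> generators X ar es" "1 \<le> i" "i < j" "j \<le> length es"
  shows "frag_extend (face_diff f i) (face_diff f j g)
    = frag_extend (face_diff f (j - 1)) (face_diff f i g)"
  using generator_faces_commute [OF assms]
  by (simp add: face_diff_def frag_extend_diff)

lemma boundary_in_chain_group:
  assumes "mutually_distributive_set X k ar f" and c: "c \<in> carrier (chain_group X k ar n)"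
  shows "boundary f n c \<in> carrier (chain_group X k ar (n - 1))"
proof -
  have "Poly_Mapping.keys (frag_extend (face_diff f i) c)
      \<subseteq> (\<Union>es\<in>index_vectors k (n - 1). generators X ar es)"
    if i: "i \<in> {1..nat (n - 1)}" for i
  proof -
    have "Poly_Mapping.keys (face_diff f i g) \<subseteq> (\<Union>es\<in>index_vectors k (n - 1). generators X ar es)"
      if g: "g \<in> Poly_Mapping.keys c" for g
    proof -
      have "g \<in> (\<Union>es\<in>index_vectors k n. generators X ar es)"
        using c g by (auto simp: chain_group_def)
      then obtain es where es: "set es \<subseteq> {1..k}" "int (length es) = n - 1" "g \<in> generators X ar es"
        by (auto simp: index_vectors_def)
      \<comment> \<open>A value of \<open>i\<close> exists only for \<open>n \<ge> 2\<close>, so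
        \<open>nat (n - 1)\<close> is the true length.\<close>
      have "i \<le> length es" using es(2) i by auto
      moreover have "take (i - 1) es @ drop i es \<in> index_vectors k (n - 1)"
        using es(1,2) i set_take_subset [of "i - 1" es] set_drop_subset [of i es]
        by (auto simp: index_vectors_def)
      ultimately have "{face_act f i g, face_omit i g}
          \<subseteq> (\<Union>es\<in>index_vectors k (n - 1). generators X ar es)"
        using face_act_in [OF assms(1) es(1,3), of i] face_omit_in [OF assms(1) es(1,3), of i] i
        by (metis UN_I atLeastAtMost_iff empty_subsetI insert_subset)
      then show ?thesis
        using keys_diff [of "frag_of (face_act f i g)" "frag_of (face_omit i g)"]
        unfolding face_diff_def keys_frag_of by blast
    qed
    then show ?thesis
      by (intro order_trans [OF keys_frag_extend] UN_least)
  qed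
  then show ?thesis
    unfolding boundary_eq_sum chain_group_def
    by (intro sum_closed_free_Abelian_group) (auto simp: free_Abelian_group_def)
qed

lemma boundary_boundary_generator:
  assumes "mutually_distributive_set X k ar f"
    and "es \<in> index_vectors k n" "g \<in> generators X ar es"
  shows "boundary f (n - 1) (boundary f n (frag_of g)) = 0"
proof -
  let ?t = "\<lambda>j i. frag_cmul ((- 1) ^ (i + j)) (frag_extend (face_diff f i) (face_diff f j g))"
  have es: "set es \<subseteq> {1..k}" "int (length es) = n - 1"
    using assms(2) by (auto simp: index_vectors_def)
  then have len: "nat (n - 1) = length es" "nat (n - 1 - 1) = length es - 1"
    by auto
  have "boundary f (n - 1) (boundary f n (frag_of g))
      = (\<Sum>i = 1..length es - 1. \<Sum>j = 1..length es. ?t j i)"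
    using len by (simp add: boundary_eq_sum frag_extend_sum frag_cmul_sum frag_extend_cmul
        power_add o_def)
  \<comment> \<open>The face applied first becomes the outer index, as the cancellation lemma
    requires.\<close>
  also have "\<dots> = (\<Sum>j = 1..length es. \<Sum>i = 1..length es - 1. ?t j i)"
    by (rule sum.swap)
  also have "\<dots> = 0"
  proof (rule alternating_double_sum_eq_0)
    fix i j :: nat
    assume "1 \<le> i" "i < j" "j \<le> length es"
    \<comment> \<open>Lowering \<open>j\<close> by one changes the parity of the exponent;
      \<open>j\<close> is positive, so the subtraction is exact.\<close>
    moreover from this have "(- 1 :: int) ^ (i + j) = - ((- 1) ^ (j - 1 + i))"
      by (cases j) (auto simp: add.commute)
    ultimately show "?t j i = - ?t i (j - 1)"
      using face_diff_commute [OF assms(1) es(1) assms(3)] by simp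
  qed
  finally show ?thesis .
qed

lemma boundary_boundary:
  assumes "mutually_distributive_set X k ar f" and "c \<in> carrier (chain_group X k ar n)"
  shows "boundary f (n - 1) (boundary f n c) = 0"
proof -
  have "Poly_Mapping.keys c \<subseteq> (\<Union>es\<in>index_vectors k n. generators X ar es)"
    using assms(2) by (simp add: chain_group_def)
  then show ?thesis
  proof (induction c rule: frag_induction)
    case (one g)
    then show ?case
      using boundary_boundary_generator [OF assms(1)] by blast
  qed (simp_all add: boundary_def frag_extend_diff)
qed

theorem lemma4p2:
  fixes X :: "'a set" and k :: nat and ar :: "nat \<Rightarrow> nat" and f :: "nat \<Rightarrow> 'a list \<Rightarrow> 'a"
  assumes "mutually_distributive_set X k ar f"
  shows "chain_complex (chain_group X k ar) (boundary f)"
  unfolding chain_complex_def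
proof (intro conjI allI ballI)
  show "comm_group (chain_group X k ar n)" for n
    by (simp add: chain_group_def abelian_free_Abelian_group)
  show "boundary f n \<in> hom (chain_group X k ar n) (chain_group X k ar (n - 1))" for n
    using boundary_in_chain_group [OF assms]
    by (auto intro!: homI simp: boundary_def frag_extend_add chain_group_def)
  \<comment> \<open>The identity of every chain group is \<open>0\<close>, whatever its
    degree.\<close>
  show "boundary f (n - 1) (boundary f n c) = \<one>\<^bsub>chain_group X k ar (n - 2)\<^esub>"
    if "c \<in> carrier (chain_group X k ar n)" for n c
    using boundary_boundary [OF assms that] by (simp add: chain_group_def)
qed

end
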